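(* Let $r>0$, $s\in\mathbb N$, $a>0$. Then for any $q\in[2,\infty)$ such that $\lambda:=a-2/q>0$, and any $N\in\mathbb N$, $$d_N\;\le\;2^r\,q^{r/(1+q)}\,\lambda^{-[qr/(1+q)]s}\,N^{-r/(1+q)},$$ where $d_N:=d_N(U^{r,a}(\mathbb T^s),L_2(\mathbb T^s))$.
   Context: $\mathbb N=\{1,2,\dots\}$. $\mathbb T^s=[-\pi,\pi]^s$ is the $s$-dimensional torus (endpoints identified in each coordinate), and $L_2(\mathbb T^s)$ carries the inner product $(f,g)=(2\pi)^{-s}\int_{\mathbb T^s}f(\mathbf x)\overline{g(\mathbf x)}\,d\mathbf x$ and norm $\|f\|=(f,f)^{1/2}$. For $\mathbf k\in\mathbb Z^s$, $e_{\mathbf k}(\mathbf x)=e^{i(\mathbf k,\mathbf x)}$, $\hat f(\mathbf k)=(f,e_{\mathbf k})$. For $a>0$ put $\lambda_a(\mathbf k):=\prod_{j=1}^s(a+|k_j|)$. The modified Korobov space $K^{r,a}(\mathbb T^s)$ is the Hilbert space of all $f=\kappa_{r,a}*g$ with $g\in L_2(\mathbb T^s)$, where $\kappa_{r,a}=\sum_{\mathbf k\in\mathbb Z^s}\lambda_a(\mathbf k)^{-r}e_{\mathbf k}$ (in the distributional sense), i.e. $\hat f(\mathbf k)=\lambda_a(\mathbf k)^{-r}\hat g(\mathbf k)$, with norm $\|f\|_{K^{r,a}(\mathbb T^s)}:=\|g\|$; equivalently $\|f\|^2_{K^{r,a}(\mathbb T^s)}=\sum_{\mathbf k\in\mathbb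 Z^s}\lambda_a(\mathbf k)^{2r}|\hat f(\mathbf k)|^2$. $U^{r,a}(\mathbb T^s)$ is the (closed) unit ball of $K^{r,a}(\mathbb T^s)$. For a normed space $X$ and a centrally symmetric $W\subset X$, the Kolmogorov $N$-width is $d_N(W,X):=\inf_{L_N}\sup_{f\in W}\inf_{g\in L_N}\|f-g\|_X$, the outer infimum over all linear subspaces $L_N\subset X$ of dimension $\le N$. *)

theory Defs
  imports "HOL-Analysis.Analysis" "HOL-Library.Function_Algebras"
begin

text \<open>Complex-valued functions on a set form a vector space over the complex numbers, with
  pointwise operations.\<close>

interpretation cfun: vector_space "\<lambda>(c::complex) (f::'a \<Rightarrow> complex) x. c * f x"
  by unfold_locales (auto simp: fun_eq_iff algebra_simps)

text \<open>The identification of opposite endpoints affects only a null set, so it plays no role for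
  the space of square-integrable functions. Values outside the cube are irrelevant throughout.\<close>

definition torus :: "(real ^ 's) set" where
  "torus = cbox (\<chi> j. - pi) (\<chi> j. pi)"

text \<open>\<^term>\<open>L2_torus\<close> consists of representatives rather than of classes modulo equality almost
  everywhere, so \<^term>\<open>L2_norm\<close> below is a seminorm on it whose null functions are those that
  vanish almost everywhere on the torus.\<close>

definition L2_torus :: "(real ^ 's \<Rightarrow> complex) set" where
  "L2_torus = {f. f \<in> borel_measurable (lebesgue_on torus) \<and>
                  integrable (lebesgue_on torus) (\<lambda>x. (cmod (f x))\<^sup>2)}"

definition L2_inner :: "(real ^ 's \<Rightarrow> complex) \<Rightarrow> (real ^ 's \<Rightarrow> complex) \<Rightarrow> complex" where
  "L2_inner f g =
     complex_of_real (1 / (2 * pi) ^ CARD('s)) * (LINT x|lebesgue_on torus. f x * cnj (g x))"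

definition L2_norm :: "(real ^ 's \<Rightarrow> complex) \<Rightarrow> real" where
  "L2_norm f = sqrt (Re (L2_inner f f))"

definition fourier_exp :: "int ^ 's \<Rightarrow> real ^ 's \<Rightarrow> complex" where
  "fourier_exp k x = exp (\<i> * complex_of_real (\<Sum>j\<in>UNIV. of_int (k $ j) * x $ j))"

definition fourier_coeff :: "(real ^ 's \<Rightarrow> complex) \<Rightarrow> int ^ 's \<Rightarrow> complex" where
  "fourier_coeff f k = L2_inner f (fourier_exp k)"

definition korobov_weight :: "real \<Rightarrow> int ^ 's \<Rightarrow> real" where
  "korobov_weight a k = (\<Prod>j\<in>UNIV. a + \<bar>of_int (k $ j)\<bar>)"

text \<open>\<^term>\<open>korobov_conv r a g f\<close> expresses that \<^term>\<open>f\<close> is the convolution of \<^term>\<open>g\<close> with the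
  kernel (in general a distribution) whose \<^term>\<open>k\<close>-th Fourier coefficient is
  \<^term>\<open>korobov_weight a k powr (- r)\<close>. These coefficients are bounded for positive \<^term>\<open>a\<close> and
  \<^term>\<open>r\<close>, so the convolution with a square-integrable function is again square-integrable and
  nothing is lost by asking for \<^term>\<open>f\<close> in \<^term>\<open>L2_torus\<close>.\<close>

definition korobov_conv ::
  "real \<Rightarrow> real \<Rightarrow> (real ^ 's \<Rightarrow> complex) \<Rightarrow> (real ^ 's \<Rightarrow> complex) \<Rightarrow> bool" where
  "korobov_conv r a g f \<longleftrightarrow> f \<in> L2_torus \<and> g \<in> L2_torus \<and>
     (\<forall>k. fourier_coeff f k = complex_of_real (korobov_weight a k powr (- r)) * fourier_coeff g k)"

definition korobov_space :: "real \<Rightarrow> real \<Rightarrow> (real ^ 's \<Rightarrow> complex) set" where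
  "korobov_space r a = {f. \<exists>g. korobov_conv r a g f}"

text \<open>The choice is immaterial: for positive \<^term>\<open>a\<close> the Fourier coefficients of \<^term>\<open>g\<close>, hence
  \<^term>\<open>g\<close> itself up to a null set, are determined by \<^term>\<open>f\<close>.\<close>

definition korobov_norm :: "real \<Rightarrow> real \<Rightarrow> (real ^ 's \<Rightarrow> complex) \<Rightarrow> real" where
  "korobov_norm r a f = L2_norm (SOME g. korobov_conv r a g f)"

definition korobov_ball :: "real \<Rightarrow> real \<Rightarrow> (real ^ 's \<Rightarrow> complex) set" where
  "korobov_ball r a = {f \<in> korobov_space r a. korobov_norm r a f \<le> 1}"

text \<open>The dimension bound is spelled out by a finite basis, since the library's \<^term>\<open>dim\<close> is a
  natural number also for infinite-dimensional spaces. For a space \<^term>\<open>X\<close> of representatives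
  with a seminorm \<^term>\<open>nrm\<close>, the width agrees with that of the associated normed quotient: images
  of subspaces under the quotient map, and lifts of bases, do not increase the dimension.\<close>

definition subspace_dim_le :: "nat \<Rightarrow> ('a \<Rightarrow> complex) set \<Rightarrow> bool" where
  "subspace_dim_le N L \<longleftrightarrow> cfun.subspace L \<and>
     (\<exists>B. cfun.independent B \<and> cfun.span B = L \<and> finite B \<and> card B \<le> N)"

definition kolmogorov_width ::
  "nat \<Rightarrow> ('a \<Rightarrow> complex) set \<Rightarrow> ('a \<Rightarrow> complex) set \<Rightarrow> (('a \<Rightarrow> complex) \<Rightarrow> real) \<Rightarrow> ennreal" where
  "kolmogorov_width N W X nrm =
     (INF L\<in>{L. L \<subseteq> X \<and> subspace_dim_le N L}. SUP f\<in>W. INF g\<in>L. ennreal (nrm (f - g)))"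

end

theory Submission
  imports Defs
begin

text \<open>Project onto the exponentials whose weight is less than \<open>T\<close>. By Parseval's identity and
  Bessel's inequality the error on the unit ball is at most \<open>T powr (- r)\<close>. The number of these
  exponentials is at most \<open>T powr (1 + q)\<close> times the sum of \<open>korobov_weight a k powr (- 1 - q)\<close> over all
  \<open>k\<close>, which is the \<open>s\<close>-th power of a one-dimensional sum. Comparison with an integral bounds the
  latter by \<open>a powr (- 1 - q) + (2 / q) * a powr (- q)\<close>, and convexity of \<open>t powr (- q)\<close> together with
  \<open>q \<ge> 2\<close> bounds this by \<open>(a - 2 / q) powr (- q)\<close>.

  In place of Parseval's identity it suffices that trigonometric polynomials are dense in the
  space of square-integrable functions. A bounded measurable function is an almost everywhere limit
  of bounded continuous functions that vanish on the faces of the cube, and those are uniform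
  limits of trigonometric polynomials by the Stone-Weierstrass theorem.\<close>

section \<open>Counting frequencies\<close>

text \<open>For \<open>x < y\<close> the mean value theorem writes the right side as
  \<open>y - x\<close> times \<open>q * z powr (- q - 1)\<close> with \<open>z\<close> in between,
  and this factor is smallest at \<open>y\<close>. It serves twice: with step 1 for telescoping and
  with step \<open>2 / q\<close> for the shift of \<open>a\<close>.\<close>

lemma powr_neg_tangent:
  fixes x y q :: real
  assumes "0 < x" "x \<le> y" "0 < q"
  shows "q * (y - x) * y powr (- q - 1) \<le> x powr (- q) - y powr (- q)"
proof (cases "x = y")
  case False
  then have "x < y" using assms by simp
  have "\<And>t. x \<le> t \<Longrightarrow> t \<le> y \<Longrightarrow> ((\<lambda>t. t powr (-q)) has_real_derivative (- q * t powr (- q - 1))) (at t)"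
    using assms by (auto intro!: derivative_eq_intros)
  from MVT2[OF \<open>x < y\<close> this] obtain z where z: "x < z" "z < y"
    "y powr (- q) - x powr (- q) = (y - x) * (- q * z powr (- q - 1))" by auto
  have "y powr (- q - 1) \<le> z powr (- q - 1)"
    using z assms by (intro powr_mono2') auto
  then have "q * (y - x) * y powr (- q - 1) \<le> q * (y - x) * z powr (- q - 1)"
    using assms \<open>x < y\<close> by (intro mult_left_mono) auto
  with z(3) show ?thesis by (simp add: algebra_simps)
qed simp

text \<open>The tangent inequality with step 1 telescopes. The subtracted end term keeps the
  induction going and is discarded only afterwards.\<close>

lemma sum_shifted_powr_le:
  fixes a q :: real
  assumes "0 < a" "0 < q"
  shows "(\<Sum>k=1..n. (a + real k) powr (- q - 1)) \<le> (a powr (- q) - (a + real n) powr (- q)) / q"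
proof (induction n)
  case (Suc n)
  have "q * (a + real (Suc n)) powr (- q - 1) \<le> (a + real n) powr (- q) - (a + real (Suc n)) powr (- q)"
    using powr_neg_tangent[of "a + real n" "a + real (Suc n)" q] assms by simp
  then have "(a + real (Suc n)) powr (- q - 1) \<le> ((a + real n) powr (- q) - (a + real (Suc n)) powr (- q)) / q"
    using assms by (simp add: field_simps)
  with Suc show ?case by (simp add: diff_divide_distrib)
qed simp

lemma sum_symmetric_powr_le:
  fixes a q :: real
  assumes "0 < a" "2 \<le> q" "0 < a - 2 / q"
  shows "(\<Sum>k=- int n..int n. (a + \<bar>of_int k\<bar>) powr (- q - 1)) \<le> (a - 2 / q) powr (- q)"
proof -
  let ?f = "\<lambda>k. (a + \<bar>real_of_int k\<bar>) powr (- q - 1)"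
  have S: "(\<Sum>k=1..int n. ?f k) = (\<Sum>k=1..n. (a + real k) powr (- q - 1))"
    by (rule sum.reindex_bij_witness[of _ int nat]) auto
  have S': "(\<Sum>k=- int n..-1. ?f k) = (\<Sum>k=1..int n. ?f k)"
    by (rule sum.reindex_bij_witness[of _ uminus uminus]) auto
  have "{- int n..int n} = {- int n..-1} \<union> {0} \<union> {1..int n}" by auto
  then have "(\<Sum>k=- int n..int n. ?f k) = (\<Sum>k=- int n..-1. ?f k) + ?f 0 + (\<Sum>k=1..int n. ?f k)"
    by (simp add: sum.union_disjoint)
  also have "\<dots> = a powr (- q - 1) + 2 * (\<Sum>k=1..n. (a + real k) powr (- q - 1))"
    unfolding S S' using assms(1) by simp
  also have "\<dots> \<le> a powr (- q - 1) + 2 * (a powr (- q) / q)"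
  proof -
    have "(a powr (- q) - (a + real n) powr (- q)) / q \<le> a powr (- q) / q"
      using assms by (simp add: divide_right_mono)
    then show ?thesis using sum_shifted_powr_le[of a q n] assms by simp
  qed
  \<comment> \<open>The coefficient 1 is raised to 2, and \<open>2 / q\<close> to 1 by
    \<open>q \<ge> 2\<close>. The result is exactly the value at \<open>a - 2 / q\<close> of the
    tangent to \<open>t powr (- q)\<close> at \<open>a\<close>.\<close>
  also have "\<dots> \<le> 2 * a powr (- q - 1) + a powr (- q)"
  proof -
    have "(2 / q) * a powr (- q) \<le> 1 * a powr (- q)"
      using assms by (intro mult_right_mono) auto
    moreover have "0 \<le> a powr (- q - 1)" by simp
    moreover have "2 * (a powr (- q) / q) = (2 / q) * a powr (- q)" by simp
    ultimately show ?thesis by linarith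
  qed
  also have "\<dots> \<le> (a - 2 / q) powr (- q)"
    using powr_neg_tangent[of "a - 2 / q" a q] assms by simp
  finally show ?thesis .
qed

lemma korobov_weight_pos: "0 < a \<Longrightarrow> 0 < korobov_weight a k"
  unfolding korobov_weight_def by (intro prod_pos) (auto intro: add_pos_nonneg)

text \<open>A finite set of frequencies lies in a cube, over which the sum of products factors into
  one-dimensional sums. The bound for these does not depend on the size of the cube, so only finite
  sums occur.\<close>

lemma sum_korobov_weight_le:
  fixes a q :: real and F :: "(int ^ 's) set"
  assumes "0 < a" "2 \<le> q" "0 < a - 2 / q" "finite F"
  shows "(\<Sum>k\<in>F. korobov_weight a k powr (- q - 1)) \<le> (a - 2 / q) powr (- q * real CARD('s))"
proof -
  \<comment> \<open>The inserted 0 keeps \<open>Max\<close> meaningful when \<open>F\<close> is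
    empty.\<close>
  define n where "n = Max (insert 0 ((\<lambda>(k, j). nat \<bar>k $ j\<bar>) ` (F \<times> UNIV)))"
  have n: "nat \<bar>k $ j\<bar> \<le> n" if "k \<in> F" for k j
    unfolding n_def using that assms(4) by (intro Max_ge) (auto intro!: image_eqI[of _ _ "(k, j)"])
  let ?I = "{- int n..int n}"
  let ?g = "\<lambda>k. (a + \<bar>real_of_int k\<bar>) powr (- q - 1)"
  have "(\<Sum>k\<in>F. korobov_weight a k powr (- q - 1)) = (\<Sum>k\<in>F. \<Prod>j\<in>UNIV. ?g (k $ j))"
    unfolding korobov_weight_def using assms
    by (intro sum.cong refl) (simp add: prod_powr_distrib)
  \<comment> \<open>Passing from vectors to functions makes the distributive law for
    \<open>PiE\<close> applicable.\<close>
  also have "\<dots> = (\<Sum>k\<in>vec_nth ` F. \<Prod>j\<in>UNIV. ?g (k j))"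
    by (subst sum.reindex) (auto simp: inj_on_def vec_nth_inject)
  also have "\<dots> \<le> (\<Sum>k\<in>((UNIV::'s set) \<rightarrow>\<^sub>E ?I). \<Prod>j\<in>UNIV. ?g (k j))"
  proof (rule sum_mono2)
    show "finite (UNIV \<rightarrow>\<^sub>E ?I :: ('s \<Rightarrow> int) set)" by (intro finite_PiE) auto
    show "vec_nth ` F \<subseteq> UNIV \<rightarrow>\<^sub>E ?I"
    proof (clarsimp simp: PiE_UNIV_domain)
      fix k j assume "k \<in> F"
      from n[OF this, of j] show "- int n \<le> k $ j \<and> k $ j \<le> int n" by linarith
    qed
  qed (simp add: prod_nonneg)
  also have "\<dots> = (\<Prod>j\<in>(UNIV::'s set). \<Sum>k\<in>?I. ?g k)"
    by (rule prod_sum_PiE[symmetric]) auto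
  also have "\<dots> = (\<Sum>k\<in>?I. ?g k) ^ CARD('s)" by simp
  also have "\<dots> \<le> ((a - 2 / q) powr (- q)) ^ CARD('s)"
    using sum_symmetric_powr_le[OF assms(1-3)] by (intro power_mono) (auto intro: sum_nonneg)
  also have "\<dots> = (a - 2 / q) powr (- q * real CARD('s))"
    using assms(3) by (simp add: powr_powr powr_realpow[symmetric])
  finally show ?thesis .
qed

text \<open>Rankin's trick with exponent \<open>1 + q\<close>.\<close>

lemma card_korobov_weight_less:
  fixes a q T :: real
  defines "G \<equiv> {k :: int ^ 's. korobov_weight a k < T}"
  assumes "0 < a" "2 \<le> q" "0 < a - 2 / q" "0 < T"
    and M: "T powr (1 + q) * (a - 2 / q) powr (- q * real CARD('s)) \<le> real M"
  shows "finite G \<and> card G \<le> M"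
\<comment> \<open>A common bound on the cardinalities of all finite subsets yields the finiteness of
  \<open>G\<close> along with its cardinality bound.\<close>
proof (rule finite_if_finite_subsets_card_bdd)
  fix F assume F: "F \<subseteq> G" "finite F"
  have "real (card F) = (\<Sum>k\<in>F. 1)" by simp
  also have "\<dots> \<le> (\<Sum>k\<in>F. T powr (1 + q) * korobov_weight a k powr (- q - 1))"
  proof (rule sum_mono)
    fix k assume "k \<in> F"
    then have "korobov_weight a k < T" using F by (auto simp: G_def)
    then have "T powr (- q - 1) \<le> korobov_weight a k powr (- q - 1)"
      using korobov_weight_pos[OF assms(2), of k] assms by (intro powr_mono2') auto
    then have "T powr (1 + q) * T powr (- q - 1) \<le> T powr (1 + q) * korobov_weight a k powr (- q - 1)"
      by (intro mult_left_mono) auto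
    then show "1 \<le> T powr (1 + q) * korobov_weight a k powr (- q - 1)"
      using assms by (simp flip: powr_add)
  qed
  also have "\<dots> = T powr (1 + q) * (\<Sum>k\<in>F. korobov_weight a k powr (- q - 1))"
    by (simp add: sum_distrib_left)
  also have "\<dots> \<le> real M"
    using mult_left_mono[OF sum_korobov_weight_le[OF assms(2-4) F(2)], of "T powr (1 + q)"] M by simp
  finally show "card F \<le> M" by simp
qed

section \<open>Square-integrable functions on the torus\<close>

lemma torus_sets [simp, measurable]: "torus \<in> sets lebesgue"
  by (simp add: torus_def)

lemma in_torus: "x \<in> torus \<longleftrightarrow> (\<forall>j. \<bar>x $ j\<bar> \<le> pi)"
  by (auto simp: torus_def mem_box_cart abs_le_iff minus_le_iff)

lemma compact_torus: "compact torus"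
  by (simp add: torus_def)

lemma measure_torus: "measure (lebesgue_on torus) (torus :: (real^'s) set) = (2 * pi) ^ CARD('s)"
proof -
  have "measure (lebesgue_on torus) (torus :: (real^'s) set) = measure lebesgue (torus :: (real^'s) set)"
    by (rule measure_restrict_space) auto
  also have "\<dots> = measure lborel (torus :: (real^'s) set)" by (simp add: torus_def)
  also have "\<dots> = (2 * pi) ^ CARD('s)"
    by (simp add: torus_def content_cbox_if_cart interval_eq_empty_cart not_less)
  finally show ?thesis .
qed

lemma finite_measure_torus: "finite_measure (lebesgue_on (torus :: (real^'s) set))"
  by (rule finite_measure_lebesgue_on) (simp add: torus_def)

lemma L2_torusI_bounded:
  assumes "f \<in> borel_measurable (lebesgue_on torus)" "\<And>x. x \<in> torus \<Longrightarrow> cmod (f x) \<le> B"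
  shows "f \<in> L2_torus"
proof -
  interpret finite_measure "lebesgue_on (torus :: (real^'a) set)" by (rule finite_measure_torus)
  have "integrable (lebesgue_on torus) (\<lambda>x. (cmod (f x))\<^sup>2)"
    using assms by (intro integrable_const_bound[where B="B\<^sup>2"] AE_I2) (auto intro: power_mono)
  then show ?thesis using assms(1) by (simp add: L2_torus_def)
qed

lemma L2_torus_measurable: "f \<in> L2_torus \<Longrightarrow> f \<in> borel_measurable (lebesgue_on torus)"
  by (simp add: L2_torus_def)

lemma L2_torus_add:
  assumes "f \<in> L2_torus" "g \<in> L2_torus"
  shows "(\<lambda>x. f x + g x) \<in> L2_torus"
proof -
  have [measurable]: "f \<in> borel_measurable (lebesgue_on torus)" "g \<in> borel_measurable (lebesgue_on torus)"
    using assms by (auto simp: L2_torus_def)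
  have "integrable (lebesgue_on torus) (\<lambda>x. (cmod (f x + g x))\<^sup>2)"
  proof (rule Bochner_Integration.integrable_bound)
    show "integrable (lebesgue_on torus) (\<lambda>x. 2 * (cmod (f x))\<^sup>2 + 2 * (cmod (g x))\<^sup>2)"
      using assms by (auto simp: L2_torus_def)
    show "AE x in lebesgue_on torus. norm ((cmod (f x + g x))\<^sup>2) \<le> norm (2 * (cmod (f x))\<^sup>2 + 2 * (cmod (g x))\<^sup>2)"
    proof (rule AE_I2)
      fix x
      have "(cmod (f x + g x))\<^sup>2 \<le> (cmod (f x) + cmod (g x))\<^sup>2"
        by (intro power_mono norm_triangle_ineq) auto
      also have "\<dots> \<le> 2 * (cmod (f x))\<^sup>2 + 2 * (cmod (g x))\<^sup>2"
        using sum_squares_bound[of "cmod (f x)" "cmod (g x)"] by (simp add: power2_sum)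
      finally show "norm ((cmod (f x + g x))\<^sup>2) \<le> norm (2 * (cmod (f x))\<^sup>2 + 2 * (cmod (g x))\<^sup>2)"
        by simp
    qed
  qed measurable
  then show ?thesis by (simp add: L2_torus_def)
qed

lemma L2_torus_scale: "f \<in> L2_torus \<Longrightarrow> (\<lambda>x. c * f x) \<in> L2_torus"
  by (auto simp: L2_torus_def norm_mult power_mult_distrib)

lemma L2_torus_diff:
  assumes "f \<in> L2_torus" "g \<in> L2_torus"
  shows "(\<lambda>x. f x - g x) \<in> L2_torus"
  using L2_torus_add[OF assms(1) L2_torus_scale[OF assms(2), of "-1"]] by simp

lemma subspace_L2_torus: "cfun.subspace L2_torus"
  unfolding cfun.subspace_def
  by (auto simp: plus_fun_def zero_fun_def intro: L2_torus_add L2_torus_scale L2_torusI_bounded[where B=0])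

lemma L2_integrable_mult:
  assumes "f \<in> L2_torus" "g \<in> L2_torus"
  shows "integrable (lebesgue_on torus) (\<lambda>x. f x * cnj (g x))"
proof (rule Bochner_Integration.integrable_bound)
  have [measurable]: "f \<in> borel_measurable (lebesgue_on torus)" "g \<in> borel_measurable (lebesgue_on torus)"
    using assms by (auto simp: L2_torus_def)
  show "integrable (lebesgue_on torus) (\<lambda>x. (cmod (f x))\<^sup>2 + (cmod (g x))\<^sup>2)"
    using assms by (auto simp: L2_torus_def)
  show "(\<lambda>x. f x * cnj (g x)) \<in> borel_measurable (lebesgue_on torus)"
    by (intro borel_measurable_times) (auto intro: borel_measurable_continuous_on[OF continuous_on_cnj[OF continuous_on_id]])
  show "AE x in lebesgue_on torus. norm (f x * cnj (g x)) \<le> norm ((cmod (f x))\<^sup>2 + (cmod (g x))\<^sup>2)"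
  proof (rule AE_I2)
    fix x
    have "2 * (cmod (f x) * cmod (g x)) \<le> (cmod (f x))\<^sup>2 + (cmod (g x))\<^sup>2"
      using sum_squares_bound[of "cmod (f x)" "cmod (g x)"] by simp
    moreover have "0 \<le> cmod (f x) * cmod (g x)" by simp
    ultimately have "cmod (f x) * cmod (g x) \<le> (cmod (f x))\<^sup>2 + (cmod (g x))\<^sup>2" by linarith
    then show "norm (f x * cnj (g x)) \<le> norm ((cmod (f x))\<^sup>2 + (cmod (g x))\<^sup>2)"
      by (simp add: norm_mult)
  qed
qed

section \<open>The inner product and its seminorm\<close>

lemma Re_L2_inner_self:
  fixes f :: "real ^ 's \<Rightarrow> complex"
  shows "Re (L2_inner f f) = (LINT x|lebesgue_on torus. (cmod (f x))\<^sup>2) / (2 * pi) ^ CARD('s)"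
proof -
  have "(LINT x|lebesgue_on torus. f x * cnj (f x))
      = complex_of_real (LINT x|lebesgue_on torus. (cmod (f x))\<^sup>2)"
    by (simp only: complex_norm_square[symmetric] of_real_power[symmetric] integral_complex_of_real)
  then have "L2_inner f f = complex_of_real ((LINT x|lebesgue_on torus. (cmod (f x))\<^sup>2) / (2 * pi) ^ CARD('s))"
    by (simp add: L2_inner_def)
  then show ?thesis by (simp only: Re_complex_of_real)
qed

lemma Re_L2_inner_self_nonneg: "0 \<le> Re (L2_inner f f)"
  by (simp add: Re_L2_inner_self)

lemma L2_norm_nonneg: "0 \<le> L2_norm f"
  by (simp add: L2_norm_def Re_L2_inner_self_nonneg)

lemma L2_norm_squared:
  fixes f :: "real ^ 's \<Rightarrow> complex"
  shows "(L2_norm f)\<^sup>2 = (LINT x|lebesgue_on torus. (cmod (f x))\<^sup>2) / (2 * pi) ^ CARD('s)"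
  unfolding Re_L2_inner_self[symmetric] L2_norm_def by (simp add: Re_L2_inner_self_nonneg)

lemma L2_inner_linear_left:
  assumes "f \<in> L2_torus" "g \<in> L2_torus" "h \<in> L2_torus"
  shows "L2_inner (\<lambda>x. f x - c * g x) h = L2_inner f h - c * L2_inner g h"
proof -
  have "(LINT x|lebesgue_on torus. (f x - c * g x) * cnj (h x))
      = (LINT x|lebesgue_on torus. f x * cnj (h x) - c * (g x * cnj (h x)))"
    by (simp add: algebra_simps)
  also have "\<dots> = (LINT x|lebesgue_on torus. f x * cnj (h x)) - c * (LINT x|lebesgue_on torus. g x * cnj (h x))"
    using L2_integrable_mult[OF assms(1,3)] L2_integrable_mult[OF assms(2,3)] by simp
  finally show ?thesis unfolding L2_inner_def by (simp only: right_diff_distrib mult.left_commute)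
qed

lemma L2_inner_commute: "L2_inner g f = cnj (L2_inner f g)"
proof -
  have "(LINT x|lebesgue_on torus. g x * cnj (f x)) = (LINT x|lebesgue_on torus. cnj (f x * cnj (g x)))"
    by (simp add: mult.commute)
  also have "\<dots> = cnj (LINT x|lebesgue_on torus. f x * cnj (g x))"
    by (rule Bochner_Integration.integral_cnj)
  finally show ?thesis by (simp add: L2_inner_def)
qed

lemma L2_inner_self: "L2_inner f f = complex_of_real ((L2_norm f)\<^sup>2)"
proof (rule complex_eqI)
  \<comment> \<open>Hermitian symmetry makes the value equal to its own conjugate.\<close>
  show "Im (L2_inner f f) = Im (complex_of_real ((L2_norm f)\<^sup>2))"
    using L2_inner_commute[of f f] by (simp add: complex_eq_iff)
  show "Re (L2_inner f f) = Re (complex_of_real ((L2_norm f)\<^sup>2))"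
    by (simp add: L2_norm_def Re_L2_inner_self_nonneg)
qed

text \<open>The scalar lets one expansion serve for differences, for sums (\<open>c = -1\<close>)
  and for the removal of a single Fourier term.\<close>

lemma L2_norm_squared_diff:
  assumes "f \<in> L2_torus" "g \<in> L2_torus"
  shows "(L2_norm (\<lambda>x. f x - c * g x))\<^sup>2
    = (L2_norm f)\<^sup>2 - 2 * Re (cnj c * L2_inner f g) + (cmod c)\<^sup>2 * (L2_norm g)\<^sup>2"
proof -
  let ?h = "\<lambda>x. f x - c * g x"
  have h: "?h \<in> L2_torus" using assms by (intro L2_torus_diff L2_torus_scale)
  have 1: "L2_inner ?h ?h = L2_inner f ?h - c * L2_inner g ?h"
    by (rule L2_inner_linear_left[OF assms h])
  have "L2_inner f ?h = cnj (L2_inner ?h f)" "L2_inner g ?h = cnj (L2_inner ?h g)"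
    by (rule L2_inner_commute)+
  then have 2: "L2_inner f ?h = L2_inner f f - cnj c * L2_inner f g"
     "L2_inner g ?h = cnj (L2_inner f g) - cnj c * L2_inner g g"
    using L2_inner_linear_left[OF assms assms(1), of c] L2_inner_linear_left[OF assms assms(2), of c]
    by (simp_all add: L2_inner_commute[of g f] L2_inner_self)
  have "complex_of_real ((L2_norm ?h)\<^sup>2) = L2_inner f f - cnj c * L2_inner f g - c * cnj (L2_inner f g) + c * cnj c * L2_inner g g"
    using 1 2 by (simp add: L2_inner_self algebra_simps)
  from arg_cong[OF this, of Re] show ?thesis
    by (simp add: L2_inner_self complex_mult_cnj cmod_power2 algebra_simps)
qed

text \<open>Parallelogram law with the squared norm of the difference dropped. It stands in for the
  triangle inequality, so that estimates stay with squared norms.\<close>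

lemma L2_norm_squared_add_le:
  fixes f g :: "real ^ 's \<Rightarrow> complex"
  assumes "f \<in> L2_torus" "g \<in> L2_torus"
  shows "(L2_norm (\<lambda>x. f x + g x))\<^sup>2 \<le> 2 * (L2_norm f)\<^sup>2 + 2 * (L2_norm g)\<^sup>2"
proof -
  have "(L2_norm (\<lambda>x. f x - g x))\<^sup>2 = (L2_norm f)\<^sup>2 - 2 * Re (L2_inner f g) + (L2_norm g)\<^sup>2"
    using L2_norm_squared_diff[OF assms, of 1] by simp
  then have "0 \<le> (L2_norm f)\<^sup>2 - 2 * Re (L2_inner f g) + (L2_norm g)\<^sup>2"
    by (metis zero_le_power2)
  then show ?thesis
    using L2_norm_squared_diff[OF assms, of "-1"] by simp
qed

lemma L2_norm_squared_scale: "(L2_norm (\<lambda>x. c * f x))\<^sup>2 = (cmod c)\<^sup>2 * (L2_norm f)\<^sup>2"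
  by (simp add: L2_norm_squared norm_mult power_mult_distrib)

section \<open>Orthonormality of the exponentials\<close>

lemma integral_exp_int:
  fixes m :: int
  shows "(LINT x|lborel. indicator {- pi..pi} x *\<^sub>R exp (\<i> * complex_of_real (of_int m * x)))
    = (if m = 0 then complex_of_real (2 * pi) else 0)"
proof (cases "m = 0")
  case True
  have "(LINT x|lborel. indicator {- pi..pi} x *\<^sub>R (1::complex)) = complex_of_real pi - complex_of_real (- pi)"
    by (rule integral_FTC_atLeastAtMost)
      (auto intro!: derivative_eq_intros has_vector_derivative_of_real continuous_intros)
  then show ?thesis using True by simp
next
  case False
  let ?F = "\<lambda>x. exp (\<i> * complex_of_real (of_int m * x)) / (\<i> * of_int m)"
  have "(LINT x|lborel. indicator {- pi..pi} x *\<^sub>R exp (\<i> * complex_of_real (of_int m * x))) = ?F pi - ?F (- pi)"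
  proof (rule integral_FTC_atLeastAtMost)
    fix x :: real
    show "(?F has_vector_derivative exp (\<i> * complex_of_real (of_int m * x))) (at x within {- pi..pi})"
    proof -
      have "((\<lambda>z. exp (\<i> * (of_int m * z)) / (\<i> * of_int m)) has_field_derivative
          exp (\<i> * (of_int m * complex_of_real x))) (at (complex_of_real x))"
        using False by (auto intro!: derivative_eq_intros simp: field_simps)
      from has_vector_derivative_real_field[OF this] show ?thesis by simp
    qed
  qed (auto intro!: continuous_intros)
  also have "\<dots> = 0"
  proof -
    \<comment> \<open>Sine vanishes at integer multiples of \<open>pi\<close> and cosine is even, so
      the antiderivative has equal values at both ends.\<close>
    have "cis (of_int m * pi) = cis (- (of_int m * pi))"
      by (simp add: complex_eq_iff sin_npi_int mult.commute)
    then show ?thesis by (simp add: cis_conv_exp mult.assoc)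
  qed
  finally show ?thesis using False by simp
qed

lemma fourier_exp_prod: "fourier_exp k x = (\<Prod>j\<in>UNIV. exp (\<i> * complex_of_real (of_int (k $ j) * x $ j)))"
  by (simp add: fourier_exp_def exp_sum sum_distrib_left)

lemma norm_fourier_exp [simp]: "cmod (fourier_exp k x) = 1"
  unfolding fourier_exp_def by simp

lemma fourier_exp_add: "fourier_exp (k + l) x = fourier_exp k x * fourier_exp l x"
  by (simp add: fourier_exp_def algebra_simps sum.distrib exp_add)

lemma fourier_exp_diff: "fourier_exp (k - l) x = fourier_exp k x * cnj (fourier_exp l x)"
proof -
  have "cnj (fourier_exp l x) = fourier_exp (- l) x"
    by (simp add: fourier_exp_def exp_cnj sum_negf)
  then show ?thesis using fourier_exp_add[of k "- l" x] by simp
qed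

lemma continuous_fourier_exp: "continuous_on S (fourier_exp k)"
  unfolding fourier_exp_def by (intro continuous_intros)

lemma fourier_exp_measurable: "fourier_exp k \<in> borel_measurable (lebesgue_on torus)"
  by (intro continuous_imp_measurable_on_sets_lebesgue continuous_fourier_exp torus_sets)

lemma fourier_exp_L2: "fourier_exp k \<in> L2_torus"
  by (rule L2_torusI_bounded[OF fourier_exp_measurable, of _ 1]) simp

text \<open>The integrand is a product of functions of one coordinate each, and
  \<open>lborel\<close> is the image of a product of one-dimensional Lebesgue measures, so the
  integral is a product too. That product is indexed by \<open>Basis\<close>, hence the passage
  between basis vectors and coordinates.\<close>

lemma integral_fourier_exp:
  fixes m :: "int ^ 's"
  shows "(LINT x|lebesgue_on torus. fourier_exp m x) = (if m = 0 then (2 * pi) ^ CARD('s) else 0)"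
proof -
  interpret product_sigma_finite "\<lambda>b::real^'s. lborel :: real measure"
    by standard
  let ?h = "\<lambda>m x. indicator {- pi..pi} x *\<^sub>R exp (\<i> * complex_of_real (of_int m * x))"
  let ?ax = "\<lambda>j::'s. axis j (1::real)"
  have ax: "inj ?ax" "Basis = range ?ax"
    by (auto simp: inj_on_def axis_eq_axis Basis_vec_def)
  have comp: "(\<Sum>b\<in>Basis. f b *\<^sub>R b) $ j = f (?ax j)" for f and j :: 's
  proof -
    have "(\<Sum>b\<in>Basis. f b *\<^sub>R b) $ j = (\<Sum>b\<in>Basis. f b *\<^sub>R b) \<bullet> ?ax j"
      by (simp add: inner_axis)
    also have "\<dots> = f (?ax j)"
      by (subst inner_sum_left_Basis) (auto simp: Basis_vec_def)
    finally show ?thesis .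
  qed
  have "(LINT x|lebesgue_on torus. fourier_exp m x) = (LINT x|lebesgue. indicator torus x *\<^sub>R fourier_exp m x)"
    by (rule integral_restrict_space) simp
  also have "\<dots> = (LINT x|lborel. indicator torus x *\<^sub>R fourier_exp m x)"
    by (intro integral_completion borel_measurable_scaleR borel_measurable_indicator
        borel_measurable_continuous_onI continuous_fourier_exp) (simp_all add: torus_def borel_measurable_continuous_onI continuous_fourier_exp)
  also have "\<dots> = (LINT x|lborel. (\<Prod>j\<in>UNIV. ?h (m $ j) (x $ j)))"
  proof (rule Bochner_Integration.integral_cong[OF refl])
    fix x :: "real^'s"
    have "indicator torus x = (\<Prod>j\<in>UNIV. indicator {- pi..pi} (x $ j) :: real)"
      by (auto simp: indicator_def in_torus abs_le_iff minus_le_iff prod.If_cases)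
    then show "indicator torus x *\<^sub>R fourier_exp m x = (\<Prod>j\<in>UNIV. ?h (m $ j) (x $ j))"
      by (simp add: fourier_exp_prod scaleR_conv_of_real prod.distrib)
  qed
  also have "\<dots> = (LINT f|(\<Pi>\<^sub>M b\<in>(Basis::(real^'s) set). lborel). (\<Prod>j\<in>UNIV. ?h (m $ j) ((\<Sum>b\<in>Basis. f b *\<^sub>R b) $ j)))"
    by (subst lborel_eq, subst integral_distr) (auto intro!: borel_measurable_prod)
  \<comment> \<open>\<open>inv ?ax\<close> recovers the coordinate from its basis vector.\<close>
  also have "\<dots> = (LINT f|(\<Pi>\<^sub>M b\<in>(Basis::(real^'s) set). lborel). (\<Prod>b\<in>Basis. ?h (m $ (inv ?ax b)) (f b)))"
    unfolding comp by (simp add: ax(2) prod.reindex[OF ax(1)] inv_f_f[OF ax(1)])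
  also have "\<dots> = (\<Prod>b\<in>(Basis::(real^'s) set). LINT x|lborel. ?h (m $ (inv ?ax b)) x)"
  proof (rule product_integral_prod)
    fix b :: "real^'s"
    show "integrable lborel (?h (m $ (inv ?ax b)))"
      using borel_integrable_atLeastAtMost'[of "- pi" pi "\<lambda>x. exp (\<i> * complex_of_real (of_int (m $ (inv ?ax b)) * x))"]
      by (simp add: set_integrable_def continuous_intros)
  qed simp
  also have "\<dots> = (\<Prod>j\<in>(UNIV::'s set). LINT x|lborel. ?h (m $ j) x)"
    by (simp add: ax(2) prod.reindex[OF ax(1)] inv_f_f[OF ax(1)])
  also have "\<dots> = (\<Prod>j\<in>(UNIV::'s set). if m $ j = 0 then complex_of_real (2 * pi) else 0)"
    by (simp only: integral_exp_int)
  also have "\<dots> = (if m = 0 then (2 * pi) ^ CARD('s) else 0)"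
    by (auto simp: vec_eq_iff)
  finally show ?thesis .
qed

lemma L2_inner_fourier_exp: "L2_inner (fourier_exp k) (fourier_exp l) = (if k = l then 1 else 0)"
  by (simp add: L2_inner_def integral_fourier_exp flip: fourier_exp_diff)

lemma L2_norm_fourier_exp: "(L2_norm (fourier_exp k))\<^sup>2 = 1"
  using L2_inner_self[of "fourier_exp k"] L2_inner_fourier_exp[of k k] by (metis of_real_eq_1_iff)

section \<open>Finite Fourier sums and Bessel's inequality\<close>

lemma trig_poly_L2: "(\<lambda>x. \<Sum>k\<in>F. c k * fourier_exp k x) \<in> L2_torus"
proof (induction F rule: infinite_finite_induct)
  case (insert k F)
  then show ?case
    using L2_torus_add[OF L2_torus_scale[OF fourier_exp_L2, of "c k" k] insert.IH] by simp
qed (auto intro: L2_torusI_bounded[where B=0])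

text \<open>By orthonormality only the coefficients at frequencies in \<open>F\<close> change. At a
  new frequency the remainder keeps the coefficient of \<open>f\<close>, which drives the induction
  for the norm.\<close>

lemma fourier_coeff_trig_poly:
  assumes "finite F" "f \<in> L2_torus"
  shows "fourier_coeff (\<lambda>x. f x - (\<Sum>k\<in>F. c k * fourier_exp k x)) l
    = fourier_coeff f l - (if l \<in> F then c l else 0)"
  using assms(1)
proof (induction F)
  case (insert k F)
  have "fourier_coeff (\<lambda>x. (f x - (\<Sum>k\<in>F. c k * fourier_exp k x)) - c k * fourier_exp k x) l
      = fourier_coeff (\<lambda>x. f x - (\<Sum>k\<in>F. c k * fourier_exp k x)) l - c k * (if k = l then 1 else 0)"
    unfolding fourier_coeff_def L2_inner_fourier_exp[symmetric]
    by (intro L2_inner_linear_left L2_torus_diff assms trig_poly_L2 fourier_exp_L2)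
  then have "fourier_coeff (\<lambda>x. f x - (\<Sum>k\<in>insert k F. c k * fourier_exp k x)) l
      = fourier_coeff f l - (if l \<in> F then c l else 0) - c k * (if k = l then 1 else 0)"
    using insert by (simp add: algebra_simps)
  then show ?case using insert(2) by (cases "k = l") auto
qed simp

text \<open>Each new frequency is orthogonal to the terms already subtracted, so its effect is
  computed separately. With the coefficients \<open>c\<close> left free, the identity gives both
  Bessel's inequality (\<open>c k = fourier_coeff f k\<close>) and the optimality of the Fourier
  coefficients.\<close>

lemma L2_norm_minus_trig_poly:
  assumes "finite F" "f \<in> L2_torus"
  shows "(L2_norm (\<lambda>x. f x - (\<Sum>k\<in>F. c k * fourier_exp k x)))\<^sup>2
    = (L2_norm f)\<^sup>2 - (\<Sum>k\<in>F. (cmod (fourier_coeff f k))\<^sup>2) + (\<Sum>k\<in>F. (cmod (c k - fourier_coeff f k))\<^sup>2)"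
  using assms(1)
proof (induction F)
  case (insert k F)
  let ?h = "\<lambda>x. f x - (\<Sum>k\<in>F. c k * fourier_exp k x)"
  have h: "?h \<in> L2_torus" by (intro L2_torus_diff assms trig_poly_L2)
  have i: "L2_inner ?h (fourier_exp k) = fourier_coeff f k"
    using fourier_coeff_trig_poly[OF insert(1) assms(2), of c k] insert(2) by (simp add: fourier_coeff_def)
  have "(L2_norm (\<lambda>x. f x - (\<Sum>k\<in>insert k F. c k * fourier_exp k x)))\<^sup>2
      = (L2_norm (\<lambda>x. ?h x - c k * fourier_exp k x))\<^sup>2"
    using insert by (simp add: algebra_simps)
  also have "\<dots> = (L2_norm ?h)\<^sup>2 - 2 * Re (cnj (c k) * fourier_coeff f k) + (cmod (c k))\<^sup>2"
    using L2_norm_squared_diff[OF h fourier_exp_L2, of "c k" k] by (simp add: i L2_norm_fourier_exp)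
  \<comment> \<open>Completing the square in \<open>c k\<close>.\<close>
  also have "\<dots> = (L2_norm ?h)\<^sup>2 - (cmod (fourier_coeff f k))\<^sup>2 + (cmod (c k - fourier_coeff f k))\<^sup>2"
    by (simp add: cmod_power2 power2_diff algebra_simps)
  finally show ?case using insert by simp
qed simp

lemma Bessel_inequality:
  assumes "finite F" "f \<in> L2_torus"
  shows "(\<Sum>k\<in>F. (cmod (fourier_coeff f k))\<^sup>2) \<le> (L2_norm f)\<^sup>2"
proof -
  have "0 \<le> (L2_norm (\<lambda>x. f x - (\<Sum>k\<in>F. fourier_coeff f k * fourier_exp k x)))\<^sup>2" by (rule zero_le_power2)
  also have "\<dots> = (L2_norm f)\<^sup>2 - (\<Sum>k\<in>F. (cmod (fourier_coeff f k))\<^sup>2)"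
    by (subst L2_norm_minus_trig_poly[OF assms]) simp
  finally show ?thesis by simp
qed

section \<open>Density of trigonometric polynomials\<close>

lemma sum_fun_apply: "(\<Sum>a\<in>A. f a) x = (\<Sum>a\<in>A. f a x)"
  for f :: "'a \<Rightarrow> 'b \<Rightarrow> 'c :: comm_monoid_add"
  by (induction A rule: infinite_finite_induct) auto

lemma cfun_span_sum:
  assumes "\<And>k. k \<in> F \<Longrightarrow> v k \<in> cfun.span S"
  shows "(\<lambda>x. \<Sum>k\<in>F. c k * v k x) \<in> cfun.span S"
proof -
  have "(\<Sum>k\<in>F. (\<lambda>x. c k * v k x)) \<in> cfun.span S"
    using assms by (intro cfun.span_sum cfun.span_scale)
  moreover have "(\<Sum>k\<in>F. (\<lambda>x. c k * v k x)) = (\<lambda>x. \<Sum>k\<in>F. c k * v k x)"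
    by (simp add: sum_fun_apply fun_eq_iff)
  ultimately show ?thesis by simp
qed

section \<open>The algebra of trigonometric polynomials\<close>

definition trig_polys :: "(real ^ 's \<Rightarrow> complex) set" where
  "trig_polys = cfun.span (range fourier_exp)"

lemma trig_polys_exp: "fourier_exp k \<in> trig_polys"
  unfolding trig_polys_def by (intro cfun.span_base) simp

lemma trig_polys_add: "p \<in> trig_polys \<Longrightarrow> q \<in> trig_polys \<Longrightarrow> (\<lambda>x. p x + q x) \<in> trig_polys"
  using cfun.span_add[of p _ q] by (simp add: trig_polys_def plus_fun_def)

lemma trig_polys_scale: "p \<in> trig_polys \<Longrightarrow> (\<lambda>x. c * p x) \<in> trig_polys"
  unfolding trig_polys_def by (rule cfun.span_scale)

lemma trig_polys_sum: "(\<And>k. k \<in> F \<Longrightarrow> v k \<in> trig_polys) \<Longrightarrow> (\<lambda>x. \<Sum>k\<in>F. c k * v k x) \<in> trig_polys"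
  unfolding trig_polys_def by (rule cfun_span_sum)

text \<open>Induction over the span, restated with pointwise operations so that its cases match
  goals about lambda terms.\<close>

lemma trig_polys_induct [consumes 1, case_names exp zero add scale]:
  assumes "p \<in> trig_polys" and "\<And>k. P (fourier_exp k)" and "P (\<lambda>x. 0)"
    and "\<And>p q. P p \<Longrightarrow> P q \<Longrightarrow> P (\<lambda>x. p x + q x)" and "\<And>c p. P p \<Longrightarrow> P (\<lambda>x. c * p x)"
  shows "P p"
  using assms(1) unfolding trig_polys_def
proof (rule cfun.span_induct)
  show "cfun.subspace (Collect P)"
    unfolding cfun.subspace_def using assms(3-5) by (simp add: plus_fun_def zero_fun_def)
qed (use assms(2) in auto)

lemma trig_polys_zero: "(\<lambda>x. 0) \<in> trig_polys"
  using trig_polys_scale[OF trig_polys_exp, of 0] by simp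

text \<open>Exponentials multiply by adding frequencies, and the product is bilinear: the outer
  induction reduces \<open>p\<close> to an exponential, the inner one then treats
  \<open>q\<close>.\<close>

lemma trig_polys_mult: "p \<in> trig_polys \<Longrightarrow> q \<in> trig_polys \<Longrightarrow> (\<lambda>x. p x * q x) \<in> trig_polys"
proof (induction p rule: trig_polys_induct)
  case (exp k)
  from exp show ?case
  proof (induction q rule: trig_polys_induct)
    case (exp l)
    have "(\<lambda>x. fourier_exp k x * fourier_exp l x) = fourier_exp (k + l)"
      by (simp add: fourier_exp_add fun_eq_iff)
    then show ?case by (simp add: trig_polys_exp)
  qed (auto simp: algebra_simps intro: trig_polys_zero dest: trig_polys_add trig_polys_scale)
qed (auto simp: algebra_simps intro: trig_polys_zero dest: trig_polys_add trig_polys_scale)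

lemma trig_polys_explicit:
  assumes "p \<in> trig_polys"
  obtains F c where "finite F" "p = (\<lambda>x. \<Sum>k\<in>F. c k * fourier_exp k x)"
proof -
  from assms obtain t r where t: "finite t" "t \<subseteq> range fourier_exp" "p = (\<Sum>a\<in>t. (\<lambda>x. r a * a x))"
    by (auto simp: trig_polys_def cfun.span_explicit)
  \<comment> \<open>A set of frequencies on which \<open>fourier_exp\<close> is injective indexes
    \<open>t\<close> without repetition, so the sum can be reindexed.\<close>
  then obtain F where F: "inj_on fourier_exp F" "t = fourier_exp ` F"
    by (auto simp: subset_image_inj)
  have "finite F" using F t(1) by (simp add: finite_image_iff)
  moreover have "p = (\<lambda>x. \<Sum>k\<in>F. r (fourier_exp k) * fourier_exp k x)"
    by (simp add: t(3) F(2) sum_fun_apply fun_eq_iff sum.reindex[OF F(1)])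
  ultimately show ?thesis by (rule that)
qed

lemma trig_polys_L2: "p \<in> trig_polys \<Longrightarrow> p \<in> L2_torus"
  by (erule trig_polys_explicit) (simp add: trig_poly_L2)

section \<open>Uniform approximation by trigonometric polynomials\<close>

lemma fourier_exp_axis: "fourier_exp (axis j m) x = cis (of_int m * x $ j)"
proof -
  have "(\<Sum>i\<in>UNIV. of_int (axis j m $ i) * x $ i) = (\<Sum>i\<in>UNIV. if i = j then of_int m * x $ i else 0)"
    by (intro sum.cong) (auto simp: axis_def)
  then show ?thesis by (simp add: fourier_exp_def cis_conv_exp)
qed

text \<open>The real coordinates of \<open>cis (x $ j)\<close> are \<open>cos (x $ j)\<close> and
  \<open>sin (x $ j)\<close>, both combinations of exponentials with frequency 1 and -1 in
  coordinate \<open>j\<close>. Constants, sums and products stay within the algebra.\<close>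

lemma real_polynomial_trig_polys:
  assumes "real_polynomial_function g"
  shows "(\<lambda>x::real^'s. complex_of_real (g (\<chi> j. cis (x $ j)))) \<in> trig_polys"
  using assms
proof induction
  case (linear g)
  then interpret bounded_linear g .
  \<comment> \<open>Euler's formulas turn \<open>A * cos t + B * sin t\<close> into
    \<open>(A - \<i> * B) / 2\<close> times \<open>cis t\<close> plus
    \<open>(A + \<i> * B) / 2\<close> times \<open>cis (- t)\<close>.\<close>
  let ?p = "\<lambda>j. (complex_of_real (g (axis j 1)) - \<i> * complex_of_real (g (axis j \<i>))) / 2"
  let ?q = "\<lambda>j. (complex_of_real (g (axis j 1)) + \<i> * complex_of_real (g (axis j \<i>))) / 2"
  have "complex_of_real (g (\<chi> j. cis (x $ j)))
      = (\<Sum>j\<in>UNIV. ?p j * fourier_exp (axis j 1) x) + (\<Sum>j\<in>UNIV. ?q j * fourier_exp (axis j (-1)) x)" for x :: "real^'s"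
  proof -
    have "(\<chi> j. cis (x $ j)) = (\<Sum>j\<in>UNIV. cos (x $ j) *\<^sub>R axis j 1 + sin (x $ j) *\<^sub>R axis j \<i>)"
    proof (simp add: vec_eq_iff, intro allI)
      fix i
      have "(\<Sum>j\<in>UNIV. cos (x $ j) *\<^sub>R axis j 1 $ i + sin (x $ j) *\<^sub>R axis j \<i> $ i)
        = (\<Sum>j\<in>UNIV. if j = i then cis (x $ j) else 0)"
        by (intro sum.cong) (auto simp: axis_def complex_eq_iff)
      then show "cis (x $ i) = (\<Sum>j\<in>UNIV. cos (x $ j) *\<^sub>R axis j 1 $ i + sin (x $ j) *\<^sub>R axis j \<i> $ i)" by simp
    qed
    then have "complex_of_real (g (\<chi> j. cis (x $ j)))
        = (\<Sum>j\<in>UNIV. complex_of_real (cos (x $ j) * g (axis j 1) + sin (x $ j) * g (axis j \<i>)))"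
      by (simp add: sum add scale)
    also have "\<dots> = (\<Sum>j\<in>UNIV. ?p j * fourier_exp (axis j 1) x + ?q j * fourier_exp (axis j (-1)) x)"
      by (intro sum.cong refl) (simp add: fourier_exp_axis complex_eq_iff field_simps)
    finally show ?thesis by (simp add: sum.distrib)
  qed
  then show ?case
    by (simp only:) (intro trig_polys_add trig_polys_sum trig_polys_exp)
next
  case (const c)
  have "fourier_exp 0 = (\<lambda>x::real^'s. 1)" by (simp add: fourier_exp_def fun_eq_iff)
  then show ?case using trig_polys_scale[OF trig_polys_exp, of "complex_of_real c" "0::int^'s"] by simp
qed (simp_all add: trig_polys_add trig_polys_mult)

text \<open>The identification of opposite faces of the cube is realised by \<open>x \<mapsto> (cis (x $ j))\<^sub>j\<close>, a
  quotient map onto its compact image. A function vanishing on the faces descends to this image,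
  and real polynomials on it pull back to trigonometric polynomials.\<close>

lemma trig_polys_uniform_approx:
  fixes u :: "real ^ 's \<Rightarrow> real"
  assumes u: "continuous_on torus u" and bd: "\<And>x j. x \<in> torus \<Longrightarrow> \<bar>x $ j\<bar> = pi \<Longrightarrow> u x = 0" and "0 < e"
  obtains p where "p \<in> trig_polys" "\<And>x. x \<in> torus \<Longrightarrow> cmod (complex_of_real (u x) - p x) < e"
proof -
  define E :: "real ^ 's \<Rightarrow> complex ^ 's" where "E x = (\<chi> j. cis (x $ j))" for x
  have E: "continuous_on torus E" unfolding E_def
    by (intro continuous_intros continuous_on_vec_lambda)
  \<comment> \<open>Coordinates with the same \<open>cis\<close> differ by a multiple of
    \<open>2 * pi\<close>; if they are distinct within the cube, both have modulus
    \<open>pi\<close>. Then both points lie on faces, where \<open>u\<close> is 0.\<close>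
  have same: "u x = u y" if "x \<in> torus" "y \<in> torus" "E x = E y" for x y
  proof (cases "x = y")
    case False
    then obtain j where j: "x $ j \<noteq> y $ j" by (auto simp: vec_eq_iff)
    have "cis (x $ j) = cis (y $ j)" using that(3) by (auto simp: E_def vec_eq_iff)
    then obtain n :: int where "\<i> * complex_of_real (x $ j) = \<i> * complex_of_real (y $ j) + of_int (2 * n) * pi * \<i>"
      by (auto simp: cis_conv_exp exp_eq)
    from arg_cong[OF this, of Im] have n: "x $ j = y $ j + 2 * pi * n" by simp
    moreover have b: "\<bar>x $ j\<bar> \<le> pi" "\<bar>y $ j\<bar> \<le> pi" using that by (auto simp: in_torus)
    ultimately have "n \<noteq> 0" "\<bar>2 * pi * real_of_int n\<bar> \<le> 2 * pi" using j by auto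
    then have "\<bar>real_of_int n\<bar> \<le> 1" by (simp add: abs_mult)
    then have "n = 1 \<or> n = -1" using \<open>n \<noteq> 0\<close> by linarith
    then have "\<bar>x $ j\<bar> = pi \<and> \<bar>y $ j\<bar> = pi" using n b by auto
    then show ?thesis using bd that by metis
  qed simp
  \<comment> \<open>\<open>u\<close> descends to the image; by \<open>same\<close> every preimage
    gives the same value.\<close>
  define v where "v z = u (SOME x. x \<in> torus \<and> E x = z)" for z
  have vE: "v (E x) = u x" if "x \<in> torus" for x
  proof -
    have "(SOME y. y \<in> torus \<and> E y = E x) \<in> torus \<and> E (SOME y. y \<in> torus \<and> E y = E x) = E x"
      by (rule someI[of _ x]) (use that in simp)
    then show ?thesis unfolding v_def using same that by metis
  qed
  \<comment> \<open>The map is closed, as its domain is compact and its target Hausdorff. Being a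
    quotient map, it transfers continuity from \<open>v \<circ> E\<close> to
    \<open>v\<close>.\<close>
  have "quotient_map (top_of_set torus) (top_of_set (E ` torus)) E"
  proof (rule continuous_closed_imp_quotient_map)
    show "continuous_map (top_of_set torus) (top_of_set (E ` torus)) E" using E by auto
    then show "closed_map (top_of_set torus) (top_of_set (E ` torus)) E"
      using compact_torus by (intro T1_Spaces.continuous_imp_closed_map)
        (auto simp: compactin_euclidean_iff Hausdorff_space_subtopology intro: compact_space_subtopology)
  qed auto
  moreover have "continuous_map (top_of_set torus) euclideanreal (v \<circ> E)"
    using continuous_on_eq[OF u, of "v \<circ> E"] by (simp add: vE)
  ultimately have "continuous_map (top_of_set (E ` torus)) euclideanreal v"
    by (rule continuous_compose_quotient_map)
  then have v: "continuous_on (E ` torus) v" by simp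
  have "compact (E ` torus)" using E compact_torus by (rule compact_continuous_image)
  then obtain g where g: "real_polynomial_function g" "\<And>z. z \<in> E ` torus \<Longrightarrow> \<bar>v z - g z\<bar> < e"
    using Stone_Weierstrass_real_polynomial_function[OF _ v \<open>0 < e\<close>] by metis
  show ?thesis
  proof (rule that)
    show "(\<lambda>x. complex_of_real (g (E x))) \<in> trig_polys"
      unfolding E_def by (rule real_polynomial_trig_polys) fact
    fix x assume "x \<in> (torus :: (real^'s) set)"
    then have "\<bar>u x - g (E x)\<bar> < e" using g(2)[of "E x"] by (simp add: vE)
    then show "cmod (complex_of_real (u x) - complex_of_real (g (E x))) < e"
      by (metis norm_of_real of_real_diff real_norm_def)
  qed
qed

section \<open>Approximation in the square-integrable seminorm\<close>

definition trig_closure :: "(real ^ 's \<Rightarrow> complex) set" where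
  "trig_closure = {f \<in> L2_torus. \<forall>e>0. \<exists>p\<in>trig_polys. (L2_norm (\<lambda>x. f x - p x))\<^sup>2 < e}"

lemma trig_closure_limit:
  assumes f: "f \<in> L2_torus" and g: "\<And>n. g n \<in> trig_closure"
    and lim: "(\<lambda>n. (L2_norm (\<lambda>x. f x - g n x))\<^sup>2) \<longlonglongrightarrow> 0"
  shows "f \<in> trig_closure"
  unfolding trig_closure_def
proof (intro CollectI conjI f allI impI)
  fix e :: real assume "0 < e"
  \<comment> \<open>Two squared errors below \<open>e / 4\<close>, each doubled by
    \<open>L2_norm_squared_add_le\<close>, sum to less than \<open>e\<close>.\<close>
  then have "eventually (\<lambda>n. (L2_norm (\<lambda>x. f x - g n x))\<^sup>2 < e / 4) sequentially"
    by (intro order_tendstoD(2)[OF lim]) simp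
  then obtain n where n: "(L2_norm (\<lambda>x. f x - g n x))\<^sup>2 < e / 4"
    by (auto simp: eventually_sequentially)
  have gn: "g n \<in> L2_torus" using g by (auto simp: trig_closure_def)
  obtain p where p: "p \<in> trig_polys" "(L2_norm (\<lambda>x. g n x - p x))\<^sup>2 < e / 4"
    using g[of n] \<open>0 < e\<close> unfolding trig_closure_def by (auto dest: spec[of _ "e / 4"])
  have "(L2_norm (\<lambda>x. f x - p x))\<^sup>2 = (L2_norm (\<lambda>x. (f x - g n x) + (g n x - p x)))\<^sup>2"
    by simp
  also have "\<dots> \<le> 2 * (L2_norm (\<lambda>x. f x - g n x))\<^sup>2 + 2 * (L2_norm (\<lambda>x. g n x - p x))\<^sup>2"
    by (intro L2_norm_squared_add_le L2_torus_diff f gn trig_polys_L2 p)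
  also have "\<dots> < e" using n p(2) by simp
  finally show "\<exists>p\<in>trig_polys. (L2_norm (\<lambda>x. f x - p x))\<^sup>2 < e" using p(1) by blast
qed

text \<open>Later \<open>c = \<i>\<close> joins the approximations of real and imaginary
  parts.\<close>

lemma trig_closure_add_scale:
  assumes f: "f \<in> trig_closure" and g: "g \<in> trig_closure"
  shows "(\<lambda>x. f x + c * g x) \<in> trig_closure"
  unfolding trig_closure_def
proof (intro CollectI conjI allI impI)
  have L: "f \<in> L2_torus" "g \<in> L2_torus" using f g by (auto simp: trig_closure_def)
  show "(\<lambda>x. f x + c * g x) \<in> L2_torus" by (intro L2_torus_add L2_torus_scale L)
  fix e :: real assume "0 < e"
  \<comment> \<open>The summand 1 keeps \<open>?M\<close> positive when \<open>c\<close> is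
    0.\<close>
  let ?M = "1 + (cmod c)\<^sup>2"
  have M: "0 < ?M" by (simp add: add_pos_nonneg)
  then have "0 < e / 4" "0 < e / (4 * ?M)" using \<open>0 < e\<close> by simp_all
  obtain p where p: "p \<in> trig_polys" "(L2_norm (\<lambda>x. f x - p x))\<^sup>2 < e / 4"
    using f \<open>0 < e / 4\<close> unfolding trig_closure_def by blast
  obtain q where q: "q \<in> trig_polys" "(L2_norm (\<lambda>x. g x - q x))\<^sup>2 < e / (4 * ?M)"
    using g \<open>0 < e / (4 * ?M)\<close> unfolding trig_closure_def by blast
  have "(cmod c)\<^sup>2 * (L2_norm (\<lambda>x. g x - q x))\<^sup>2 \<le> ?M * (e / (4 * ?M))"
    using q(2) M by (intro mult_mono) auto
  also have "\<dots> = e / 4" using M by (simp add: divide_simps)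
  finally have cq: "(cmod c)\<^sup>2 * (L2_norm (\<lambda>x. g x - q x))\<^sup>2 \<le> e / 4" .
  have "(L2_norm (\<lambda>x. (f x + c * g x) - (p x + c * q x)))\<^sup>2 = (L2_norm (\<lambda>x. (f x - p x) + c * (g x - q x)))\<^sup>2"
    by (simp add: algebra_simps)
  also have "\<dots> \<le> 2 * (L2_norm (\<lambda>x. f x - p x))\<^sup>2 + 2 * (L2_norm (\<lambda>x. c * (g x - q x)))\<^sup>2"
    by (intro L2_norm_squared_add_le L2_torus_diff L2_torus_scale L trig_polys_L2 p q)
  also have "\<dots> < e" using p(2) cq unfolding L2_norm_squared_scale by linarith
  finally show "\<exists>p\<in>trig_polys. (L2_norm (\<lambda>x. f x + c * g x - p x))\<^sup>2 < e"
    using trig_polys_add[OF p(1) trig_polys_scale[OF q(1), of c]] by (intro bexI)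
qed

text \<open>The squared pointwise error meets the hypotheses of dominated convergence. Convergence
  is asked for almost everywhere, as the continuous approximants of a measurable function can fail
  on a null set.\<close>

lemma L2_dominated_convergence:
  fixes f :: "real ^ 's \<Rightarrow> complex"
  assumes f: "f \<in> L2_torus" and g: "\<And>n. g n \<in> L2_torus"
    and w: "integrable (lebesgue_on torus) w"
    and dom: "\<And>n x. x \<in> torus \<Longrightarrow> (cmod (f x - g n x))\<^sup>2 \<le> w x"
    and lim: "AE x in lebesgue_on torus. (\<lambda>n. g n x) \<longlonglongrightarrow> f x"
  shows "(\<lambda>n. (L2_norm (\<lambda>x. f x - g n x))\<^sup>2) \<longlonglongrightarrow> 0"
proof -
  note [measurable] = L2_torus_measurable[OF f] L2_torus_measurable[OF g]
  have "(\<lambda>n. LINT x|lebesgue_on torus. (cmod (f x - g n x))\<^sup>2) \<longlonglongrightarrow> (LINT x|lebesgue_on (torus :: (real^'s) set). 0)"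
  proof (rule integral_dominated_convergence[where w=w])
    show "AE x in lebesgue_on torus. (\<lambda>n. (cmod (f x - g n x))\<^sup>2) \<longlonglongrightarrow> 0"
      using lim
    proof (rule AE_mp, intro AE_I2 impI)
      fix x assume "(\<lambda>n. g n x) \<longlonglongrightarrow> f x"
      then have "(\<lambda>n. (cmod (f x - g n x))\<^sup>2) \<longlonglongrightarrow> (cmod (f x - f x))\<^sup>2"
        by (intro tendsto_intros)
      then show "(\<lambda>n. (cmod (f x - g n x))\<^sup>2) \<longlonglongrightarrow> 0" by simp
    qed
    show "AE x in lebesgue_on torus. norm ((cmod (f x - g n x))\<^sup>2) \<le> w x" for n
      using dom by (intro AE_I2) simp
  qed (use w in auto)
  from tendsto_divide[OF this tendsto_const[of "(2 * pi) ^ CARD('s)"]] show ?thesis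
    by (simp add: L2_norm_squared)
qed

lemma trig_closure_continuous:
  fixes u :: "real ^ 's \<Rightarrow> real"
  assumes u: "continuous_on torus u" and bd: "\<And>x j. x \<in> torus \<Longrightarrow> \<bar>x $ j\<bar> = pi \<Longrightarrow> u x = 0"
  shows "(\<lambda>x. complex_of_real (u x)) \<in> trig_closure"
  unfolding trig_closure_def
proof (intro CollectI conjI allI impI)
  have "compact (u ` torus)" by (intro compact_continuous_image u compact_torus)
  then obtain B where "\<And>x. x \<in> torus \<Longrightarrow> \<bar>u x\<bar> \<le> B"
    using compact_imp_bounded bounded_iff by (metis imageI real_norm_def)
  moreover have "(\<lambda>x. complex_of_real (u x)) \<in> borel_measurable (lebesgue_on torus)"
    by (intro continuous_imp_measurable_on_sets_lebesgue continuous_on_of_real u torus_sets)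
  ultimately show L: "(\<lambda>x. complex_of_real (u x)) \<in> L2_torus"
    by (intro L2_torusI_bounded[where B=B]) auto
  fix e :: real assume "0 < e"
  \<comment> \<open>The seminorm is normalised by the volume of the cube, so a uniform error
    \<open>sqrt (e / 2)\<close> costs at most \<open>e / 2\<close> in the square; halving restores
    strictness after integration.\<close>
  then have "0 < sqrt (e / 2)" by simp
  then obtain p where p: "p \<in> trig_polys" "\<And>x. x \<in> torus \<Longrightarrow> cmod (complex_of_real (u x) - p x) < sqrt (e / 2)"
    using trig_polys_uniform_approx[OF u] bd by metis
  interpret finite_measure "lebesgue_on (torus :: (real^'s) set)" by (rule finite_measure_torus)
  have "(\<lambda>x. complex_of_real (u x) - p x) \<in> L2_torus"
    by (intro L2_torus_diff L trig_polys_L2 p)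
  then have i: "integrable (lebesgue_on torus) (\<lambda>x. (cmod (complex_of_real (u x) - p x))\<^sup>2)"
    by (simp add: L2_torus_def)
  have "(LINT x|lebesgue_on torus. (cmod (complex_of_real (u x) - p x))\<^sup>2) \<le> (LINT x|lebesgue_on (torus::(real^'s) set). e / 2)"
  proof (rule integral_mono[OF i])
    fix x assume "x \<in> space (lebesgue_on (torus :: (real^'s) set))"
    then have "cmod (complex_of_real (u x) - p x) < sqrt (e / 2)" using p(2) by simp
    then have "(cmod (complex_of_real (u x) - p x))\<^sup>2 \<le> (sqrt (e / 2))\<^sup>2"
      by (intro power_mono) auto
    then show "(cmod (complex_of_real (u x) - p x))\<^sup>2 \<le> e / 2" using \<open>0 < e\<close> by simp
  qed simp
  also have "\<dots> = (2 * pi) ^ CARD('s) * (e / 2)" using measure_torus[where 's='s] by simp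
  finally have "(L2_norm (\<lambda>x. complex_of_real (u x) - p x))\<^sup>2 \<le> e / 2"
    by (simp add: L2_norm_squared divide_le_eq mult.commute)
  also have "\<dots> < e" using \<open>0 < e\<close> by simp
  finally show "\<exists>p\<in>trig_polys. (L2_norm (\<lambda>x. complex_of_real (u x) - p x))\<^sup>2 < e"
    using p(1) by blast
qed

lemma trig_closure_bounded_real:
  fixes f :: "real ^ 's \<Rightarrow> real"
  assumes f: "f \<in> borel_measurable (lebesgue_on torus)" and B: "\<And>x. \<bar>f x\<bar> \<le> B"
  shows "(\<lambda>x. complex_of_real (f x)) \<in> trig_closure"
proof -
  have "0 \<le> B" using B[of 0] by linarith
  have "f measurable_on torus"
    using f by (simp add: measurable_on_iff_borel_measurable)
  \<comment> \<open>\<open>measurable_on\<close> supplies functions continuous on the whole space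
    that converge, off a negligible set, to \<open>f\<close> extended by 0.\<close>
  then obtain N g where N: "negligible N" and g: "\<And>n. continuous_on UNIV (g n)"
    and lim: "\<And>x. x \<notin> N \<Longrightarrow> (\<lambda>n. g n x) \<longlonglongrightarrow> (if x \<in> torus then f x else 0)"
    unfolding measurable_on_def by blast
  define d :: "real ^ 's \<Rightarrow> real" where "d x = (\<Prod>j\<in>UNIV. pi - \<bar>x $ j\<bar>)" for x
  \<comment> \<open>The second factor makes \<open>u n\<close> vanish on the faces and tends to 1 in the interior.\<close>
  define u :: "nat \<Rightarrow> real ^ 's \<Rightarrow> real" where
    "u n x = max (- B) (min B (g n x)) * min 1 (real n * d x)" for n x
  have d0: "0 \<le> d x" if "x \<in> torus" for x
    using that unfolding d_def by (intro prod_nonneg) (auto simp: in_torus)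
  have ub: "\<bar>u n x\<bar> \<le> B" if "x \<in> torus" for n x
  proof -
    have "\<bar>u n x\<bar> \<le> B * 1"
      unfolding u_def abs_mult using \<open>0 \<le> B\<close> d0[OF that] by (intro mult_mono) auto
    then show ?thesis by simp
  qed
  have un: "(\<lambda>x. complex_of_real (u n x)) \<in> trig_closure" for n
  proof (rule trig_closure_continuous)
    show "continuous_on torus (u n)"
      unfolding u_def d_def by (intro continuous_intros continuous_on_subset[OF g]) auto
    fix x :: "real ^ 's" and j assume "\<bar>x $ j\<bar> = pi"
    then have "d x = 0" unfolding d_def by (intro prod_zero bexI[of _ j]) auto
    then show "u n x = 0" by (simp add: u_def)
  qed
  have fL: "(\<lambda>x. complex_of_real (f x)) \<in> L2_torus"
    using f B by (intro L2_torusI_bounded[where B=B]) (auto intro: borel_measurable_of_real)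
  interpret finite_measure "lebesgue_on (torus :: (real^'s) set)" by (rule finite_measure_torus)
  show ?thesis
  proof (rule trig_closure_limit[OF fL un], rule L2_dominated_convergence[OF fL, where w="\<lambda>x. (2 * B)\<^sup>2"])
    show "(\<lambda>x. complex_of_real (u n x)) \<in> L2_torus" for n using un by (simp add: trig_closure_def)
    show "(cmod (complex_of_real (f x) - complex_of_real (u n x)))\<^sup>2 \<le> (2 * B)\<^sup>2" if "x \<in> torus" for n x
    proof -
      have "\<bar>f x - u n x\<bar> \<le> 2 * B" using B[of x] ub[OF that, of n] by linarith
      then show ?thesis
        by (metis norm_of_real of_real_diff abs_ge_zero power_mono)
    qed
    \<comment> \<open>\<open>?Z\<close> adds the faces, where \<open>d\<close> vanishes, to the
      exceptional set \<open>N\<close>.\<close>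
    let ?Z = "N \<union> (torus - box (\<chi> j. - pi) (\<chi> j. pi) :: (real^'s) set)"
    have "negligible ?Z"
      using N negligible_frontier_interval by (simp add: torus_def)
    then have "AE x in lebesgue. x \<notin> ?Z"
      by (intro AE_not_in) (simp add: negligible_iff_null_sets)
    then have "AE x in lebesgue_on torus. x \<notin> ?Z"
      by (subst AE_restrict_space_iff) (auto elim: eventually_mono)
    then show "AE x in lebesgue_on torus. (\<lambda>n. complex_of_real (u n x)) \<longlonglongrightarrow> complex_of_real (f x)"
    proof (rule AE_mp, intro AE_I2 impI)
      fix x :: "real ^ 's"
      assume "x \<in> space (lebesgue_on torus)" and Z: "x \<notin> ?Z"
      then have x: "x \<in> torus" "x \<in> box (\<chi> j. - pi) (\<chi> j. pi)" "x \<notin> N" by auto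
      have "\<bar>x $ j\<bar> < pi" for j using x(2) by (auto simp: mem_box_cart abs_less_iff minus_less_iff)
      then have "0 < d x" unfolding d_def by (intro prod_pos) auto
      \<comment> \<open>Since \<open>d x\<close> is positive in the interior, the cutoff factor is
        eventually 1 and only the clamped \<open>g n x\<close> remains.\<close>
      obtain n0 where "1 \<le> real n0 * d x" using reals_Archimedean3[OF \<open>0 < d x\<close>] less_imp_le by blast
      then have "min 1 (real n * d x) = 1" if "n \<ge> n0" for n
        using that \<open>0 < d x\<close> by (smt (verit) mult_right_mono of_nat_mono)
      then have "eventually (\<lambda>n. max (- B) (min B (g n x)) = u n x) sequentially"
        by (auto simp: eventually_sequentially u_def)
      \<comment> \<open>Clamping between \<open>- B\<close> and \<open>B\<close> is continuous and
        fixes \<open>f x\<close>, so it preserves the limit.\<close>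
      moreover have "(\<lambda>n. max (- B) (min B (g n x))) \<longlonglongrightarrow> max (- B) (min B (f x))"
        using lim[OF x(3)] x(1) by (intro tendsto_intros) simp
      moreover have "max (- B) (min B (f x)) = f x" using B[of x] by auto
      ultimately have "(\<lambda>n. u n x) \<longlonglongrightarrow> f x" using Lim_transform_eventually by fastforce
      then show "(\<lambda>n. complex_of_real (u n x)) \<longlonglongrightarrow> complex_of_real (f x)" by (rule tendsto_of_real)
    qed
  qed simp
qed

text \<open>Setting \<open>f\<close> to 0 where its modulus exceeds \<open>n\<close> gives bounded
  functions, whose real and imaginary parts are covered by \<open>trig_closure_bounded_real\<close>.
  The error is either 0 or \<open>f\<close>, so the squared modulus of \<open>f\<close> dominates,
  and at each point it is eventually 0.\<close>

lemma L2_torus_subset_trig_closure: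
  assumes f: "f \<in> L2_torus"
  shows "f \<in> trig_closure"
proof -
  note fm [measurable] = L2_torus_measurable[OF f]
  define h where "h n x = (if cmod (f x) \<le> real n then f x else 0)" for n x
  have hm [measurable]: "h n \<in> borel_measurable (lebesgue_on torus)" for n
    unfolding h_def by measurable
  have hb: "cmod (h n x) \<le> real n" for n x by (simp add: h_def)
  have hn: "h n \<in> trig_closure" for n
  proof -
    have "(\<lambda>x. complex_of_real (Re (h n x))) \<in> trig_closure" "(\<lambda>x. complex_of_real (Im (h n x))) \<in> trig_closure"
      using hb[of n] by (intro trig_closure_bounded_real[where B="real n"]; force intro: order_trans[OF abs_Re_le_cmod] order_trans[OF abs_Im_le_cmod])+
    from trig_closure_add_scale[OF this, of \<i>] show ?thesis
      by (simp flip: complex_eq)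
  qed
  show ?thesis
  proof (rule trig_closure_limit[OF f hn], rule L2_dominated_convergence[OF f])
    show "h n \<in> L2_torus" for n using hn by (simp add: trig_closure_def)
    show "integrable (lebesgue_on torus) (\<lambda>x. (cmod (f x))\<^sup>2)" using f by (simp add: L2_torus_def)
    show "(cmod (f x - h n x))\<^sup>2 \<le> (cmod (f x))\<^sup>2" for n x by (simp add: h_def)
    show "AE x in lebesgue_on torus. (\<lambda>n. h n x) \<longlonglongrightarrow> f x"
    proof (rule AE_I2)
      fix x
      obtain n0 where "cmod (f x) \<le> real n0" using real_arch_simple by blast
      then have "eventually (\<lambda>n. f x = h n x) sequentially"
        by (auto simp: eventually_sequentially h_def intro!: exI[of _ n0])
      then show "(\<lambda>n. h n x) \<longlonglongrightarrow> f x"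
        by (rule Lim_transform_eventually[OF tendsto_const])
    qed
  qed
qed

section \<open>The width of the Korobov ball\<close>

text \<open>This takes the place of Parseval's identity. A trigonometric polynomial near
  \<open>f\<close> with frequencies in \<open>F\<close> shows that the coefficients in
  \<open>F\<close> carry the squared norm of \<open>f\<close> up to \<open>e\<close>; those outside
  \<open>G\<close> contribute at most \<open>B\<close>.\<close>

lemma L2_norm_le_partial_sums:
  fixes f :: "real ^ 's \<Rightarrow> complex"
  assumes f: "f \<in> L2_torus" and "finite G"
    and B: "\<And>F. finite F \<Longrightarrow> F \<inter> G = {} \<Longrightarrow> (\<Sum>k\<in>F. (cmod (fourier_coeff f k))\<^sup>2) \<le> B"
  shows "(L2_norm (\<lambda>x. f x - (\<Sum>k\<in>G. fourier_coeff f k * fourier_exp k x)))\<^sup>2 \<le> B"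
proof (rule field_le_epsilon)
  fix e :: real assume "0 < e"
  then obtain p where p: "p \<in> trig_polys" "(L2_norm (\<lambda>x. f x - p x))\<^sup>2 < e"
    using L2_torus_subset_trig_closure[OF f] by (auto simp: trig_closure_def)
  obtain F c where F: "finite F" "p = (\<lambda>x. \<Sum>k\<in>F. c k * fourier_exp k x)"
    using trig_polys_explicit[OF p(1)] .
  let ?C = "\<lambda>k. (cmod (fourier_coeff f k))\<^sup>2"
  have "(L2_norm (\<lambda>x. f x - (\<Sum>k\<in>G. fourier_coeff f k * fourier_exp k x)))\<^sup>2 = (L2_norm f)\<^sup>2 - sum ?C G"
    by (subst L2_norm_minus_trig_poly[OF \<open>finite G\<close> f]) simp
  \<comment> \<open>Replacing Fourier coefficients by others cannot decrease the error: the last sum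
    in \<open>L2_norm_minus_trig_poly\<close> is nonnegative.\<close>
  moreover have "(L2_norm f)\<^sup>2 - sum ?C F \<le> (L2_norm (\<lambda>x. f x - p x))\<^sup>2"
    unfolding F(2) L2_norm_minus_trig_poly[OF F(1) f] by (simp add: sum_nonneg)
  moreover have "sum ?C F \<le> sum ?C (G \<union> F)"
    using F(1) \<open>finite G\<close> by (intro sum_mono2) auto
  moreover have "sum ?C (G \<union> F) = sum ?C G + sum ?C (F - G)"
    using F(1) \<open>finite G\<close> by (metis Un_Diff_cancel Diff_disjoint finite_Diff sum.union_disjoint)
  moreover have "sum ?C (F - G) \<le> B" using F(1) by (intro B) auto
  ultimately show "(L2_norm (\<lambda>x. f x - (\<Sum>k\<in>G. fourier_coeff f k * fourier_exp k x)))\<^sup>2 \<le> B + e"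
    using p(2) by linarith
qed

text \<open>Outside the chosen frequencies the multiplier
  \<open>korobov_weight a k powr (- r)\<close> is at most \<open>T powr (- r)\<close>, and Bessel's
  inequality bounds the squared coefficients of the preimage \<open>g\<close> by 1 in total.\<close>

lemma korobov_ball_approx:
  fixes f :: "real ^ 's \<Rightarrow> complex"
  assumes f: "f \<in> korobov_ball r a" and "0 < r" "0 < a" "0 < T"
    and fin: "finite {k :: int ^ 's. korobov_weight a k < T}" (is "finite ?G")
  shows "L2_norm (\<lambda>x. f x - (\<Sum>k | korobov_weight a k < T. fourier_coeff f k * fourier_exp k x)) \<le> T powr (- r)"
proof -
  \<comment> \<open>The same choice as in \<open>korobov_norm\<close>, so membership in the ball
    bounds the norm of exactly this \<open>g\<close>.\<close>
  define g where "g = (SOME g. korobov_conv r a g f)"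
  have "korobov_conv r a g f"
    unfolding g_def using f by (intro someI_ex[of "\<lambda>g. korobov_conv r a g f"]) (simp add: korobov_ball_def korobov_space_def)
  then have fL: "f \<in> L2_torus" and gL: "g \<in> L2_torus"
    and fg: "\<And>k. fourier_coeff f k = complex_of_real (korobov_weight a k powr (- r)) * fourier_coeff g k"
    by (auto simp: korobov_conv_def)
  have "L2_norm g \<le> 1" using f by (simp add: korobov_ball_def korobov_norm_def g_def)
  then have g1: "(L2_norm g)\<^sup>2 \<le> 1" using L2_norm_nonneg[of g] by (simp add: power_le_one)
  have "(L2_norm (\<lambda>x. f x - (\<Sum>k\<in>?G. fourier_coeff f k * fourier_exp k x)))\<^sup>2 \<le> (T powr (- r))\<^sup>2"
  proof (rule L2_norm_le_partial_sums[OF fL fin])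
    fix F :: "(int ^ 's) set" assume F: "finite F" "F \<inter> ?G = {}"
    have "(\<Sum>k\<in>F. (cmod (fourier_coeff f k))\<^sup>2) \<le> (\<Sum>k\<in>F. (T powr (- r))\<^sup>2 * (cmod (fourier_coeff g k))\<^sup>2)"
    proof (rule sum_mono)
      fix k assume "k \<in> F"
      then have "T \<le> korobov_weight a k" using F(2) by force
      then have "korobov_weight a k powr (- r) \<le> T powr (- r)"
        using assms(2,4) by (intro powr_mono2') auto
      then have "cmod (fourier_coeff f k) \<le> T powr (- r) * cmod (fourier_coeff g k)"
        by (simp add: fg norm_mult mult_right_mono)
      then have "(cmod (fourier_coeff f k))\<^sup>2 \<le> (T powr (- r) * cmod (fourier_coeff g k))\<^sup>2"
        by (intro power_mono) auto
      then show "(cmod (fourier_coeff f k))\<^sup>2 \<le> (T powr (- r))\<^sup>2 * (cmod (fourier_coeff g k))\<^sup>2"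
        by (simp add: power_mult_distrib)
    qed
    also have "\<dots> \<le> (T powr (- r))\<^sup>2 * 1"
      unfolding sum_distrib_left[symmetric]
      using Bessel_inequality[OF F(1) gL] g1 by (intro mult_left_mono) auto
    finally show "(\<Sum>k\<in>F. (cmod (fourier_coeff f k))\<^sup>2) \<le> (T powr (- r))\<^sup>2" by simp
  qed
  then show ?thesis by (rule power2_le_imp_le) simp
qed

text \<open>One admissible subspace is enough for an upper bound on the width, and within it the
  partial Fourier sum of each \<open>f\<close> is close enough.\<close>

lemma kolmogorov_width_korobov_ball_le:
  fixes r a T :: real
  assumes "0 < r" "0 < a" "0 < T"
    and G: "finite {k :: int ^ 's. korobov_weight a k < T}" "card {k :: int ^ 's. korobov_weight a k < T} \<le> N"
  shows "kolmogorov_width N (korobov_ball r a :: (real ^ 's \<Rightarrow> complex) set) L2_torus L2_norm \<le> ennreal (T powr (- r))"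
proof -
  define G where "G = {k :: int ^ 's. korobov_weight a k < T}"
  let ?L = "cfun.span (fourier_exp ` G)"
  have fin: "finite (fourier_exp ` G)" and card: "card (fourier_exp ` G) \<le> N"
    using G card_image_le[OF G(1), of fourier_exp] by (auto simp: G_def)
  have "?L \<subseteq> L2_torus"
    by (intro cfun.span_minimal subspace_L2_torus) (auto simp: fourier_exp_L2)
  moreover have "subspace_dim_le N ?L"
  proof -
    \<comment> \<open>\<open>subspace_dim_le\<close> asks for an independent basis. Extracting one
      from the spanning set avoids proving the exponentials independent and cannot raise the
      cardinality.\<close>
    obtain B where B: "B \<subseteq> fourier_exp ` G" "cfun.independent B" "fourier_exp ` G \<subseteq> cfun.span B"
      using cfun.maximal_independent_subset[of "fourier_exp ` G"] by metis
    have "cfun.span B = ?L"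
      using B by (intro antisym cfun.span_mono cfun.span_minimal cfun.subspace_span)
    moreover have "finite B" using B(1) fin by (rule finite_subset)
    moreover have "card B \<le> N" using card_mono[OF fin B(1)] card by simp
    ultimately show ?thesis unfolding subspace_dim_le_def using B(2) cfun.subspace_span by blast
  qed
  ultimately have "kolmogorov_width N (korobov_ball r a :: (real ^ 's \<Rightarrow> complex) set) L2_torus L2_norm
      \<le> (SUP f\<in>korobov_ball r a. INF g\<in>?L. ennreal (L2_norm (f - g)))"
    unfolding kolmogorov_width_def by (intro INF_lower) simp
  also have "\<dots> \<le> ennreal (T powr (- r))"
  proof (rule SUP_least)
    fix f :: "real ^ 's \<Rightarrow> complex" assume f: "f \<in> korobov_ball r a"
    let ?p = "\<lambda>x. \<Sum>k\<in>G. fourier_coeff f k * fourier_exp k x"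
    have "?p \<in> ?L" by (rule cfun_span_sum) (auto intro: cfun.span_base)
    then have "(INF g\<in>?L. ennreal (L2_norm (f - g))) \<le> ennreal (L2_norm (f - ?p))"
      by (rule INF_lower)
    also have "\<dots> \<le> ennreal (T powr (- r))"
      using korobov_ball_approx[OF f assms(1-3) G(1)] by (intro ennreal_leI) (simp add: G_def fun_diff_def)
    finally show "(INF g\<in>?L. ennreal (L2_norm (f - g))) \<le> ennreal (T powr (- r))" .
  qed
  finally show ?thesis .
qed

theorem theorem4p6:
  fixes r a q lam :: real and N :: nat
  assumes "r > 0" and "a > 0" and "q \<ge> 2" and "lam = a - 2 / q" and "lam > 0" and "N \<ge> 1"
  shows "kolmogorov_width N (korobov_ball r a :: (real ^ 's \<Rightarrow> complex) set) L2_torus L2_norm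
    \<le> ennreal (2 powr r * q powr (r / (1 + q)) * lam powr (- (q * r / (1 + q)) * real CARD('s))
               * real N powr (- (r / (1 + q))))"
proof -
  let ?s = "real CARD('s)"
  \<comment> \<open>\<open>T\<close> is chosen such that \<open>T powr (- r)\<close> is the claimed bound; the number of frequencies of weight
    below \<open>T\<close> is then smaller than \<open>N\<close> even by a factor \<open>q * 2 powr (1 + q)\<close>.\<close>
  define T where "T = 2 powr (- 1) * q powr (- (1 / (1 + q))) * lam powr (q / (1 + q) * ?s) * real N powr (1 / (1 + q))"
  have T: "0 < T" unfolding T_def using assms by simp
  \<comment> \<open>The left side is the counting bound at the threshold \<open>T\<close>; the power
    of \<open>lam\<close> in \<open>T\<close> is made to cancel the one from the count.\<close>
  have "T powr (1 + q) * lam powr (- q * ?s) = 2 powr (- (1 + q)) * q powr (- 1) * real N"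
  proof -
    have "- (1 / (1 + q)) * (1 + q) = - 1" "q / (1 + q) * ?s * (1 + q) = q * ?s" "1 / (1 + q) * (1 + q) = 1"
      using assms(3) by (simp_all add: field_simps)
    then have "T powr (1 + q) = 2 powr (- (1 + q)) * q powr (- 1) * lam powr (q * ?s) * real N"
      using assms(6) by (simp only: T_def powr_mult powr_powr) simp
    moreover have "lam powr (q * ?s) * lam powr (- q * ?s) = 1"
      using assms(5) by (simp flip: powr_add)
    ultimately show ?thesis by simp
  qed
  also have "\<dots> \<le> 2 powr 0 * 1 * real N"
    using assms by (intro mult_mono) (auto simp del: powr_zero_eq_one simp: powr_minus_divide[of q 1] intro!: powr_mono)
  finally have "T powr (1 + q) * (a - 2 / q) powr (- q * ?s) \<le> real N" using assms(4) by simp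
  then have "finite {k :: int ^ 's. korobov_weight a k < T} \<and> card {k :: int ^ 's. korobov_weight a k < T} \<le> N"
    using assms T by (intro card_korobov_weight_less) auto
  then have "kolmogorov_width N (korobov_ball r a :: (real ^ 's \<Rightarrow> complex) set) L2_torus L2_norm \<le> ennreal (T powr (- r))"
    using assms T by (intro kolmogorov_width_korobov_ball_le) auto
  also have "T powr (- r) = 2 powr r * q powr (r / (1 + q)) * lam powr (- (q * r / (1 + q)) * ?s) * real N powr (- (r / (1 + q)))"
    unfolding T_def powr_mult powr_powr by (simp add: mult_ac)
  finally show ?thesis .
qed

end
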